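(* For every $n\geq 1$, let $D_n=\mathrm{des}(s(\sigma))+1$, where $\sigma$ is chosen uniformly at random from $S_{n-1}$. Then \[\sum_{n\geq 1}\frac{\mathbb E(D_n^2)}{n}z^n=\frac{2+7z-(3+5z-3z^2+z^3)e^z+e^{2z}}{(1-z)^2}.\] The variances of the random variables $D_n$ satisfy $\mathrm{Var}(D_n)\sim(2+2e-e^2)n$ as $n\to\infty$.
   Context: $S_n$ is the set of permutations of $\{1,\dots,n\}$ written in one-line notation ($S_0$ contains only the empty permutation). $\mathrm{des}(\pi)$ is the number of descents of $\pi=\pi_1\cdots\pi_n$, i.e. indices $i\in\{1,\dots,n-1\}$ with $\pi_i>\pi_{i+1}$. West's stack-sorting map $s$ is defined recursively on permutations of finite sets of positive integers: $s$ of the empty permutation is empty, and if $\pi=LmR$ with $m$ the largest entry of $\pi$, then $s(\pi)=s(L)\,s(R)\,m$. The first identity is an identity of formal power series in $z$. *)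

theory Defs
  imports
    "HOL-Probability.Probability"
    "HOL-Combinatorics.Multiset_Permutations"
    "HOL-Computational_Algebra.Formal_Power_Series"
    "HOL-Library.Landau_Symbols"
begin

(* Permutations in one-line notation are lists; S_n is permutations_of_set {1..n}.
   List indices start at 0, so i below is the paper's index minus 1. *)
definition des :: "nat list \<Rightarrow> nat" where
  "des p = card {i. Suc i < length p \<and> p ! i > p ! Suc i}"

(* For a nonempty list without repetitions, takeWhile and tl o dropWhile cut it at its
   largest entry m into L and R with p = L @ m # R; see stack_sort_append below. *)
function stack_sort :: "nat list \<Rightarrow> nat list" where
  "stack_sort p =
     (if p = [] then []
      else let m = Max (set p);
               L = takeWhile (\<lambda>x. x \<noteq> m) p;
               R = tl (dropWhile (\<lambda>x. x \<noteq> m) p)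
           in stack_sort L @ stack_sort R @ [m])"
  by pat_completeness auto
termination
proof (relation "Wellfounded.measure length", goal_cases)
  case (2 p m L)
  then have "m \<in> set p" by simp
  then have "dropWhile (\<lambda>x. x \<noteq> m) p \<noteq> []"
    by (auto simp: dropWhile_eq_Nil_conv)
  moreover have "length (takeWhile (\<lambda>x. x \<noteq> m) p) +
      length (dropWhile (\<lambda>x. x \<noteq> m) p) = length p"
    by (metis length_append takeWhile_dropWhile_id)
  ultimately show ?case using 2 by (cases "dropWhile (\<lambda>x. x \<noteq> m) p") auto
next
  case (3 p m L R)
  have "length (dropWhile (\<lambda>x. x \<noteq> m) p) \<le> length p"
    by (rule length_dropWhile_le)
  then show ?case using 3 by (cases p) auto
qed auto

declare stack_sort.simps [simp del]

lemma stack_sort_Nil: "stack_sort [] = []"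
  by (simp add: stack_sort.simps)

lemma stack_sort_append:
  assumes "distinct (L @ m # R)" and "\<forall>x \<in> set L \<union> set R. x \<le> m"
  shows "stack_sort (L @ m # R) = stack_sort L @ stack_sort R @ [m]"
proof -
  have "Max (set (L @ m # R)) = m"
    using assms(2) by (intro Max_eqI) auto
  moreover have "takeWhile (\<lambda>x. x \<noteq> m) (L @ m # R) = L"
    using assms(1) by (subst takeWhile_append2) auto
  moreover have "dropWhile (\<lambda>x. x \<noteq> m) (L @ m # R) = m # R"
    using assms(1) by (subst dropWhile_append2) auto
  ultimately show ?thesis
    by (subst stack_sort.simps) (simp add: Let_def)
qed

definition unif_perm :: "nat \<Rightarrow> nat list pmf" where
  "unif_perm n = pmf_of_set (permutations_of_set {1..n})"

(* D_n is this function on the probability space unif_perm (n - 1), i.e. on uniform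
   permutations in S_(n-1); n enters only through that space. *)
definition D :: "nat list \<Rightarrow> real" where
  "D \<sigma> = real (des (stack_sort \<sigma>) + 1)"

end

theory Submission imports Defs begin

text \<open>
  Write a nonempty permutation as $LmR$ with largest entry $m$, so that its image under the map $s$
  is $s(L)\,s(R)\,m$.  The last entry of $s(L)$ is the largest entry of $L$; hence, for nonempty $L$
  and $R$, besides the descents inside $s(L)$ and $s(R)$ there is exactly one more, unless
  $\max L$ is below the first entry of $s(R)$.  The exceptional pairs are what has to be counted.

  Say that a list $R$ of distinct elements of $U$ dominates $U$ if the first entry of $s(R)$ exceeds
  every element of $U$ that is not in $R$.  Let a chain of length $j$ on $U$ be a splitting of $U$
  into nonempty lists $R_1, \dots, R_j$ in which $R_i$ dominates the union of $R_1, \dots, R_i$ for each $i$,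
  and weight it by $t$ to the total number of descents of the $s(R_i)$.  Chains of length one are
  the permutations of a nonempty $U$.  If the largest entry $m$ is removed from the last list of a chain, that
  list becomes $LmR$ with $L$ dominating what is left without $R$, and then the exceptional condition
  says precisely that $R$ dominates too, that is, that replacing $LmR$ by $L, R$ gives a chain with
  one list more (\<open>extend_insert_max\<close>).  So the exponential generating functions $Y_j(z)$ of
  chains satisfy
  \[Y_0 = 1, \qquad Y_j' = Y_{j-1} + (2 + t\,Y_1)\,Y_j + (1 - t)\,Y_{j+1}, \qquad Y_j(0) = 0
    \quad (j \ge 1).\]

  Expand around $t = 1 + \varepsilon$.  The coefficient of $\varepsilon^i$ in $t^d$ is
  ${d \choose i}$, so the first three coefficients of $Y_1$ give the mean and the second moment.
  The factor $1 - t = -\varepsilon$ lowers the order by one whenever it raises $j$, so the infinite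
  system becomes triangular.  At order zero $Y_1$ just counts permutations, and five linear
  differential equations of first order then determine $Y_1$ up to order two, $Y_2$ up to order one
  and $Y_3$ at order zero, all in terms of $z$, $e^z$ and $1/(1-z)$.  The derivative of
  $\sum_n E(D_n^2) z^n / n$ is the exponential generating function of $(d + 1)^2$ summed over all
  permutations, where $d$ is the number of descents after sorting.  As
  $(d + 1)^2 = 1 + 3 d + 2 {d \choose 2}$, the first identity is obtained by comparing the derivative
  of its right-hand side with the corresponding combination of the functions found.

  For the variance, $\sum_n E(D_n) z^n / n = M(z)/(1-z)$ and $\sum_n E(D_n^2) z^n / n = N(z)/(1-z)^2$
  with entire $M$ and $N$.  The coefficients of such quotients are $M(1)$ and $(n+1) N(1) - N'(1)$ up to
  errors that stay negligible after multiplication by $n$.  As $N(1) = M(1)^2 = (3 - e)^2$, the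
  quadratic terms of the variance cancel, and $N(1) - N'(1) = 2 + 2 e - e^2$ is left as the
  coefficient of $n$.  It is positive because $e < 1 + \sqrt 3$.
\<close>

section \<open>Stack-sorting and descents around the largest entry\<close>

lemma max_split:
  assumes "distinct p" "p \<noteq> []"
  obtains L m R where "p = L @ m # R" "\<forall>x\<in>set L \<union> set R. x < (m::nat)"
proof -
  obtain L R where p: "p = L @ Max (set p) # R"
    using assms(2) by (meson Max_in List.finite_set set_empty split_list)
  have "x < Max (set p)" if "x \<in> set L \<union> set R" for x
  proof -
    have "x \<in> set p" using that by (subst p) auto
    moreover have "x \<noteq> Max (set p)"
    proof
      assume "x = Max (set p)"
      moreover have "distinct (L @ Max (set p) # R)" using p assms(1) by simp
      ultimately show False using that by auto
    qed
    ultimately show ?thesis by (simp add: order.strict_iff_order)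
  qed
  then show ?thesis using that p by blast
qed

text \<open>The induction along which the map is defined, with the largest entry named and not computed by
  \<^term>\<open>Max\<close>.\<close>

lemma distinct_max_induct [consumes 1, case_names Nil split]:
  assumes "distinct p" "P []"
    and "\<And>L m R. distinct (L @ m # R) \<Longrightarrow> \<forall>x\<in>set L \<union> set R. x < (m::nat) \<Longrightarrow>
      P L \<Longrightarrow> P R \<Longrightarrow> P (L @ m # R)"
  shows "P p"
  using assms(1)
proof (induction "length p" arbitrary: p rule: less_induct)
  case less
  show ?case
  proof (cases "p = []")
    case False
    then obtain L m R where p: "p = L @ m # R" "\<forall>x\<in>set L \<union> set R. x < m"
      using max_split less.prems by blast
    show ?thesis unfolding p(1)
      by (rule assms(3)) (use p less in auto)
  qed (use assms in simp)
qed

lemma stack_sort_max: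
  assumes "distinct (L @ m # R)" "\<forall>x\<in>set L \<union> set R. x < m"
  shows "stack_sort (L @ m # R) = stack_sort L @ stack_sort R @ [m]"
  using assms by (intro stack_sort_append) (auto simp: less_imp_le)

lemma set_stack_sort: "distinct p \<Longrightarrow> set (stack_sort p) = set p"
  by (induction p rule: distinct_max_induct) (auto simp: stack_sort_Nil stack_sort_max)

lemma stack_sort_eq_Nil_iff: "distinct p \<Longrightarrow> stack_sort p = [] \<longleftrightarrow> p = []"
  by (metis set_stack_sort set_empty)

lemma last_stack_sort: "distinct p \<Longrightarrow> p \<noteq> [] \<Longrightarrow> last (stack_sort p) = Max (set p)"
proof (induction p rule: distinct_max_induct)
  case (split L m R)
  then have "Max (set (L @ m # R)) = m"
    by (intro Max_eqI) (auto simp: less_imp_le)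
  then show ?case using split by (simp add: stack_sort_max)
qed simp

lemma hd_stack_sort_in: "distinct p \<Longrightarrow> p \<noteq> [] \<Longrightarrow> hd (stack_sort p) \<in> set p"
  by (metis hd_in_set set_stack_sort stack_sort_eq_Nil_iff)

lemma des_Nil: "des [] = 0" and des_single: "des [x] = 0"
  by (auto simp: des_def)

lemma des_Cons_Cons: "des (x # y # zs) = des (y # zs) + of_bool (y < x)"
proof -
  have "{i. Suc i < length (x # y # zs) \<and> (x # y # zs) ! i > (x # y # zs) ! Suc i} =
    Suc ` {i. Suc i < length (y # zs) \<and> (y # zs) ! i > (y # zs) ! Suc i} \<union> (if y < x then {0} else {})"
    (is "?A = Suc ` ?B \<union> ?C")
  proof (rule set_eqI)
    fix i show "i \<in> ?A \<longleftrightarrow> i \<in> Suc ` ?B \<union> ?C" by (cases i) auto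
  qed
  moreover have "finite ?B" by (rule finite_subset[of _ "{..<length (y # zs)}"]) auto
  ultimately show ?thesis
    unfolding des_def by (simp add: card_image)
qed

lemma des_append:
  assumes "xs \<noteq> []" "ys \<noteq> []"
  shows "des (xs @ ys) = des xs + des ys + of_bool (hd ys < last xs)"
  using assms(1)
proof (induction xs)
  case (Cons x xs)
  show ?case
  proof (cases xs)
    case Nil
    then show ?thesis using assms(2) by (cases ys) (auto simp: des_single des_Cons_Cons)
  next
    case (Cons a list)
    then show ?thesis using Cons.IH by (simp add: des_Cons_Cons)
  qed
qed simp

lemma des_snoc_max: "xs \<noteq> [] \<Longrightarrow> last xs \<le> m \<Longrightarrow> des (xs @ [m]) = des xs"
  by (simp add: des_append des_single)

section \<open>Removing the largest entry from a chain\<close>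

definition dominating :: "nat set \<Rightarrow> nat list set" where
  "dominating U = {p. distinct p \<and> p \<noteq> [] \<and> set p \<subseteq> U \<and> (\<forall>x\<in>U - set p. x < hd (stack_sort p))}"

definition arrangements :: "nat set \<Rightarrow> nat list set" where
  "arrangements U = {p. distinct p \<and> p \<noteq> [] \<and> set p \<subseteq> U}"

definition sort_weight :: "'a::comm_ring_1 \<Rightarrow> nat list \<Rightarrow> 'a" where
  "sort_weight t p = t ^ des (stack_sort p)"

lemma finite_arrangements: "finite U \<Longrightarrow> finite (arrangements U)"
  by (rule finite_subset[OF _ finite_subset_distinct[of U]]) (auto simp: arrangements_def)

lemma dominating_subset: "dominating U \<subseteq> arrangements U"
  by (auto simp: dominating_def arrangements_def)

lemma finite_dominating: "finite U \<Longrightarrow> finite (dominating U)"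
  using finite_subset[OF dominating_subset finite_arrangements] .

text \<open>A dominating list must contain the largest entry \<open>m\<close>, since nothing in it could exceed
  \<open>m\<close> otherwise.  Cut it at \<open>m\<close>.  The first entry of its image is the first entry of the
  image of \<open>L\<close> whenever \<open>L\<close> is nonempty, so domination is then a condition on \<open>L\<close> alone,
  relative to the elements not used by an arbitrary \<open>R\<close>.\<close>

lemma dominating_insert_max:
  assumes V: "finite V" "\<forall>x\<in>V. x < m"
  shows "dominating (insert m V) =
    {[m]} \<union> (\<lambda>p. p @ [m]) ` dominating V \<union> (\<lambda>p. m # p) ` dominating V \<union>
    (\<lambda>(R, L). L @ m # R) ` (SIGMA R:arrangements V. dominating (V - set R))" (is "?lhs = ?rhs")
proof (intro equalityI subsetI)
  fix p assume p: "p \<in> ?lhs"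
  then have dp: "distinct p" "p \<noteq> []" "set p \<subseteq> insert m V"
    and rest: "\<forall>x\<in>insert m V - set p. x < hd (stack_sort p)" by (auto simp: dominating_def)
  have hm: "hd (stack_sort p) \<le> m"
    using hd_stack_sort_in[OF dp(1,2)] dp(3) V by (auto simp: order.strict_iff_order)
  then have "m \<in> set p" using rest by (meson DiffI insertI1 leD)
  then obtain L R where pe: "p = L @ m # R" by (meson split_list)
  have LR: "distinct (L @ m # R)" "\<forall>x\<in>set L \<union> set R. x < m"
    using dp V unfolding pe by auto
  note ss = stack_sort_max[OF LR]
  have rest': "x < hd (stack_sort L @ stack_sort R @ [m])" if "x \<in> V" "x \<notin> set L" "x \<notin> set R" for x
    using rest that V unfolding pe ss by auto
  have sub: "set L \<subseteq> V" "set R \<subseteq> V" using dp LR unfolding pe by auto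
  have ne: "stack_sort L = [] \<longleftrightarrow> L = []" "stack_sort R = [] \<longleftrightarrow> R = []"
    using LR by (auto simp: stack_sort_eq_Nil_iff)
  show "p \<in> ?rhs"
  proof (cases "L = []"; cases "R = []")
    assume "L \<noteq> []" "R \<noteq> []"
    then have "(R, L) \<in> (SIGMA R:arrangements V. dominating (V - set R))"
      using rest' sub LR ne by (auto simp: arrangements_def dominating_def)
    then show ?thesis unfolding pe by force
  next
    assume "L \<noteq> []" "R = []"
    then have "L \<in> dominating V"
      using rest' sub LR ne by (auto simp: dominating_def)
    then show ?thesis using \<open>R = []\<close> unfolding pe by blast
  next
    assume "L = []" "R \<noteq> []"
    then have "R \<in> dominating V"
      using rest' sub LR ne by (auto simp: dominating_def stack_sort_Nil)
    then show ?thesis using \<open>L = []\<close> unfolding pe by auto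
  qed (auto simp: pe)
next
  fix p assume "p \<in> ?rhs"
  then obtain L R where pe: "p = L @ m # R" and LR: "distinct (L @ R)" "set L \<union> set R \<subseteq> V"
    and rest: "\<forall>x\<in>V - set L - set R. x < hd (stack_sort L @ stack_sort R @ [m])"
  proof (elim UnE)
    assume "p \<in> {[m]}"
    then show ?thesis using that[of "[]" "[]"] V by (simp add: stack_sort_Nil)
  next
    assume "p \<in> (\<lambda>p. p @ [m]) ` dominating V"
    then obtain L where "L \<in> dominating V" "p = L @ [m]" by blast
    then show ?thesis using that[of L "[]"] by (auto simp: dominating_def stack_sort_Nil stack_sort_eq_Nil_iff)
  next
    assume "p \<in> (\<lambda>p. m # p) ` dominating V"
    then obtain R where "R \<in> dominating V" "p = m # R" by blast
    then show ?thesis using that[of "[]" R] by (auto simp: dominating_def stack_sort_Nil stack_sort_eq_Nil_iff)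
  next
    assume "p \<in> (\<lambda>(R, L). L @ m # R) ` (SIGMA R:arrangements V. dominating (V - set R))"
    then obtain R L where "R \<in> arrangements V" "L \<in> dominating (V - set R)" "p = L @ m # R" by auto
    then show ?thesis using that[of L R]
      by (auto simp: dominating_def arrangements_def stack_sort_eq_Nil_iff)
  qed
  have "distinct (L @ m # R)" "\<forall>x\<in>set L \<union> set R. x < m" using LR V by auto
  then show "p \<in> ?lhs"
    using LR rest V unfolding pe by (auto simp: dominating_def stack_sort_max)
qed

text \<open>The junction of the two images is a descent unless the largest entry of \<open>L\<close>, which ends the
  first image, is below the first entry of the second one; the final \<open>m\<close> never adds a descent.\<close>

lemma sort_weight_split:
  assumes "distinct (L @ m # R)" "\<forall>x\<in>set L \<union> set R. x < m" "L \<noteq> []" "R \<noteq> []"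
  shows "sort_weight t (L @ m # R) =
    sort_weight t L * sort_weight t R * (if Max (set L) < hd (stack_sort R) then 1 else t)"
proof -
  have d: "distinct L" "distinct R" using assms by auto
  then have ne: "stack_sort L \<noteq> []" "stack_sort R \<noteq> []"
    using assms by (auto simp: stack_sort_eq_Nil_iff)
  have "last (stack_sort R) \<in> set R"
    using set_stack_sort[OF d(2)] last_in_set[OF ne(2)] by simp
  then have "last (stack_sort R) \<le> m" using assms by (auto simp: less_imp_le)
  moreover have "Max (set L) \<in> set L" using assms by simp
  then have "hd (stack_sort R) \<noteq> Max (set L)"
    using hd_stack_sort_in[OF d(2) assms(4)] assms(1) by auto
  ultimately show ?thesis
    using assms ne d unfolding sort_weight_def
    by (auto simp: stack_sort_max des_append[of "stack_sort L"] des_snoc_max last_stack_sort power_add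
        simp del: Max_less_iff)
qed

lemma sort_weight_max_at_end:
  assumes "distinct L" "\<forall>x\<in>set L. x < m"
  shows "sort_weight t (L @ [m]) = sort_weight t L" "sort_weight t (m # L) = sort_weight t L"
proof -
  have "des (stack_sort L @ [m]) = des (stack_sort L)"
  proof (cases "L = []")
    case False
    then have "last (stack_sort L) < m"
      using assms Max_in[of "set L"] by (simp add: last_stack_sort)
    then show ?thesis using assms False by (intro des_snoc_max) (auto simp: stack_sort_eq_Nil_iff)
  qed (simp add: stack_sort_Nil des_Nil des_single)
  then show "sort_weight t (L @ [m]) = sort_weight t L" "sort_weight t (m # L) = sort_weight t L"
    using stack_sort_max[of L m "[]"] stack_sort_max[of "[]" m L] assms
    by (auto simp: sort_weight_def stack_sort_Nil)
qed

text \<open>In generating functions, this appends a dominating list to a structure of type \<open>\<Phi>\<close> on the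
  remaining elements.  Working in an arbitrary commutative ring allows \<open>t\<close> to be a perturbation of
  \<open>1\<close> later.\<close>

definition extend :: "'a::comm_ring_1 \<Rightarrow> (nat set \<Rightarrow> 'a) \<Rightarrow> nat set \<Rightarrow> 'a" where
  "extend t \<Phi> U = (\<Sum>p\<in>dominating U. \<Phi> (U - set p) * sort_weight t p)"

definition perm_sum :: "'a::comm_ring_1 \<Rightarrow> nat set \<Rightarrow> 'a" where
  "perm_sum t U = (\<Sum>p | p \<noteq> [] \<and> p \<in> permutations_of_set U. sort_weight t p)"

text \<open>The key recurrence.  The four summands correspond to the ways in which the last list can be cut at
  its largest entry \<open>m\<close>: both parts empty, one part empty (twice), and both nonempty.  In the last
  case the junction contributes \<open>t\<close>, corrected to \<open>1\<close> for the exceptional pairs, which accounts for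
  \<open>t\<close> times all pairs plus \<open>1 - t\<close> times the exceptional ones.  Among the pairs with \<open>L\<close>
  dominating \<open>V - set R\<close>, the exceptional ones are those in which \<open>R\<close> dominates \<open>V\<close>, so they are
  again pairs of successive extensions, and no new kind of structure arises.\<close>

lemma extend_insert_max:
  fixes t :: "'a::comm_ring_1"
  assumes V: "finite V" "\<forall>x\<in>V. x < m"
  shows "extend t \<Phi> (insert m V) = \<Phi> V + 2 * extend t \<Phi> V
     + t * (\<Sum>S\<in>Pow V. extend t \<Phi> (V - S) * perm_sum t S)
     + (1 - t) * extend t (extend t \<Phi>) V"
proof -
  let ?f = "\<lambda>p. \<Phi> (insert m V - set p) * sort_weight t p"
  let ?S = "SIGMA R:arrangements V. dominating (V - set R)"
  let ?c = "\<lambda>(R, L). L @ m # R"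
  let ?w = "\<lambda>R L. \<Phi> (V - set R - set L) * sort_weight t L * sort_weight t R"
  have mV: "m \<notin> V" using V by auto
  have fin: "finite (dominating V)" "finite ?S"
    using V by (auto simp: finite_dominating finite_arrangements)
  have sub: "set p \<subseteq> V" "p \<noteq> []" "distinct p" if "p \<in> dominating V" for p
    using that by (auto simp: dominating_def)
  have subS: "set R \<subseteq> V" "set L \<subseteq> V" "distinct (L @ m # R)" "L \<noteq> []" "R \<noteq> []" if "(R, L) \<in> ?S" for R L
    using that mV by (auto simp: dominating_def arrangements_def)
  have V1: "m \<notin> set p" if "set p \<subseteq> V" for p using that mV by auto
  have cut: "L = L' \<and> R = R'" if "L @ m # R = L' @ m # R'" "m \<notin> set L" "m \<notin> set R" for L R L' R'
    using that append_Cons_eq_iff by metis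
  have disj1: "{[m]} \<inter> (\<lambda>p. p @ [m]) ` dominating V = {}" "{[m]} \<inter> (\<lambda>p. m # p) ` dominating V = {}"
    using sub(2) by auto
  have disj2: "(\<lambda>p. p @ [m]) ` dominating V \<inter> (\<lambda>p. m # p) ` dominating V = {}"
  proof -
    have "L @ [m] \<noteq> m # R" if "L \<in> dominating V" "R \<in> dominating V" for L R
      using cut[of L "[]" "[]" R] sub[OF that(1)] V1 by auto
    then show ?thesis by blast
  qed
  have disj3: "{[m]} \<inter> ?c ` ?S = {}" "(\<lambda>p. p @ [m]) ` dominating V \<inter> ?c ` ?S = {}"
    "(\<lambda>p. m # p) ` dominating V \<inter> ?c ` ?S = {}"
  proof -
    have "q @ m # r \<noteq> L @ m # R" if "(R, L) \<in> ?S" "q = [] \<or> r = []" for q r R L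
      using cut[of L R q r] subS[OF that(1)] that(2) by auto
    from this[where r = "[]"] this[where q = "[]"]
    show "{[m]} \<inter> ?c ` ?S = {}" "(\<lambda>p. p @ [m]) ` dominating V \<inter> ?c ` ?S = {}"
      "(\<lambda>p. m # p) ` dominating V \<inter> ?c ` ?S = {}"
      by (force simp del: mem_Sigma_iff)+
  qed
  have "extend t \<Phi> (insert m V) =
      sum ?f {[m]} + sum ?f ((\<lambda>p. p @ [m]) ` dominating V) + sum ?f ((\<lambda>p. m # p) ` dominating V)
      + sum ?f (?c ` ?S)"
    unfolding extend_def dominating_insert_max[OF V]
    using fin disj1 disj2 disj3 by (simp add: sum.union_disjoint Int_Un_distrib2)
  also have "sum ?f {[m]} = \<Phi> V"
    using mV by (simp add: sort_weight_def stack_sort_max[of "[]" m "[]", simplified] stack_sort_Nil des_single)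
  also have "sum ?f ((\<lambda>p. p @ [m]) ` dominating V) = extend t \<Phi> V"
    unfolding extend_def
    by (subst sum.reindex)
      (use V mV sub in \<open>auto simp: inj_on_def sort_weight_max_at_end subset_iff intro!: sum.cong\<close>)
  also have "sum ?f ((\<lambda>p. m # p) ` dominating V) = extend t \<Phi> V"
    unfolding extend_def
    by (subst sum.reindex)
      (use V mV sub in \<open>auto simp: inj_on_def sort_weight_max_at_end subset_iff intro!: sum.cong\<close>)
  also have "sum ?f (?c ` ?S) = (\<Sum>(R, L)\<in>?S. ?w R L *
        (if Max (set L) < hd (stack_sort R) then 1 else t))"
  proof (subst sum.reindex)
    show "inj_on ?c ?S"
    proof (rule inj_onI)
      fix x y assume x: "x \<in> ?S" and xy: "?c x = ?c y"
      obtain R L R' L' where eqs: "x = (R, L)" "y = (R', L')" by (metis surj_pair)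
      show "x = y"
        using cut[of L R L' R'] subS(1,2)[of R L] V1[of L] V1[of R] x xy unfolding eqs by simp
    qed
  next
    have "?f (L @ m # R) = ?w R L *
        (if Max (set L) < hd (stack_sort R) then 1 else t)" if "(R, L) \<in> ?S" for R L
    proof -
      have "insert m V - set (L @ m # R) = V - set R - set L" using mV by auto
      moreover have "sort_weight t (L @ m # R) =
          sort_weight t L * sort_weight t R * (if Max (set L) < hd (stack_sort R) then 1 else t)"
        using subS[OF that] V by (intro sort_weight_split) auto
      ultimately show ?thesis by (simp add: mult_ac)
    qed
    then show "sum (?f \<circ> ?c) ?S = (\<Sum>(R, L)\<in>?S. ?w R L *
        (if Max (set L) < hd (stack_sort R) then 1 else t))"
      by (intro sum.cong refl) (simp only: o_apply split_paired_all case_prod_conv)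
  qed
  also have "\<dots> = (\<Sum>(R, L)\<in>?S. t * ?w R L +
       (1 - t) * (if R \<in> dominating V then ?w R L else 0))"
  proof (intro sum.cong refl, clarify)
    fix R L assume RL: "R \<in> arrangements V" "L \<in> dominating (V - set R)"
    then have L: "distinct L" "L \<noteq> []" "set L \<subseteq> V - set R" and R: "distinct R" "R \<noteq> []" "set R \<subseteq> V"
      and LR: "\<forall>x\<in>V - set R - set L. x < hd (stack_sort L)"
      by (auto simp: arrangements_def dominating_def)
    \<comment> \<open>The entries outside \<open>L\<close> and \<open>R\<close> are below the first entry of the image of \<open>L\<close>, hence
      below the largest entry of \<open>L\<close>; so only the latter has to be compared.\<close>
    have "Max (set L) < hd (stack_sort R) \<longleftrightarrow> R \<in> dominating V"
    proof
      assume *: "Max (set L) < hd (stack_sort R)"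
      have le: "x \<le> Max (set L)" if "x \<in> set L" for x using that by simp
      have "x < hd (stack_sort R)" if "x \<in> V - set R" for x
      proof (cases "x \<in> set L")
        case False
        then have "x < hd (stack_sort L)" using LR that by auto
        then show ?thesis using le[OF hd_stack_sort_in[OF L(1,2)]] * by simp
      next
        case True
        then show ?thesis using le[of x] * by linarith
      qed
      then show "R \<in> dominating V" using R by (auto simp: dominating_def)
    next
      assume "R \<in> dominating V"
      then show "Max (set L) < hd (stack_sort R)"
        using L Max_in[of "set L"] by (auto simp: dominating_def)
    qed
    then show "?w R L * (if Max (set L) < hd (stack_sort R) then 1 else t) =
       t * ?w R L +
       (1 - t) * (if R \<in> dominating V then ?w R L else 0)"
      by (simp add: algebra_simps)
  qed
  also have "\<dots> = t * (\<Sum>(R, L)\<in>?S. ?w R L) +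
       (1 - t) * (\<Sum>(R, L)\<in>?S. if R \<in> dominating V then ?w R L else 0)"
    by (simp add: sum.distrib sum_distrib_left case_prod_unfold)
  also have "(\<Sum>(R, L)\<in>?S. ?w R L) = (\<Sum>R\<in>arrangements V. extend t \<Phi> (V - set R) * sort_weight t R)"
    using V by (subst sum.Sigma[symmetric]) 
      (auto simp: finite_arrangements finite_dominating extend_def sum_distrib_right)
  \<comment> \<open>Without the junction condition, \<open>R\<close> is an arbitrary ordering of its set of entries \<open>S\<close>.\<close>
  also have "\<dots> = (\<Sum>S\<in>Pow V. \<Sum>R | R \<in> arrangements V \<and> set R = S. extend t \<Phi> (V - set R) * sort_weight t R)"
    using finite_arrangements[OF V(1)] V by (intro sum.group[symmetric]) (auto simp: arrangements_def)
  also have "\<dots> = (\<Sum>S\<in>Pow V. extend t \<Phi> (V - S) * perm_sum t S)"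
    unfolding perm_sum_def sum_distrib_left
    by (intro sum.cong) (auto simp: arrangements_def permutations_of_set_def)
  also have "(\<Sum>(R, L)\<in>?S. if R \<in> dominating V then ?w R L else 0)
     = (\<Sum>R\<in>arrangements V. if R \<in> dominating V then extend t \<Phi> (V - set R) * sort_weight t R else 0)"
    using V by (subst sum.Sigma[symmetric]) 
      (auto simp: finite_arrangements finite_dominating extend_def sum_distrib_right intro!: sum.cong)
  also have "\<dots> = (\<Sum>R\<in>dominating V. extend t \<Phi> (V - set R) * sort_weight t R)"
    using V dominating_subset[of V]
    by (subst sum.inter_restrict[symmetric]) (auto simp: finite_arrangements intro!: sum.cong)
  also have "\<dots> = extend t (extend t \<Phi>) V"
    by (simp add: extend_def)
  finally show ?thesis by (simp add: algebra_simps)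
qed

section \<open>Chains and their recurrence\<close>

definition at_empty :: "nat set \<Rightarrow> 'a::comm_ring_1" where
  "at_empty U = of_bool (U = {})"

definition chain_gf :: "'a::comm_ring_1 \<Rightarrow> nat \<Rightarrow> nat set \<Rightarrow> 'a" where
  "chain_gf t j = (extend t ^^ j) at_empty"

lemma chain_gf_0: "chain_gf t 0 = at_empty" and chain_gf_Suc: "chain_gf t (Suc j) = extend t (chain_gf t j)"
  by (auto simp: chain_gf_def)

lemma chain_gf_Suc_empty: "chain_gf t (Suc j) {} = 0"
  by (simp add: chain_gf_Suc extend_def dominating_def)

text \<open>The first list of a chain has nothing left to dominate, so it is just a permutation.\<close>

lemma perm_sum_eq_chain_gf: "finite U \<Longrightarrow> perm_sum t U = chain_gf t 1 U"
proof -
  assume U: "finite U"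
  have "(\<Sum>p\<in>dominating U. at_empty (U - set p) * sort_weight t p) =
        (\<Sum>p\<in>dominating U. if p \<in> {p. set p = U} then sort_weight t p else 0)"
    by (intro sum.cong) (auto simp: at_empty_def dominating_def)
  also have "\<dots> = (\<Sum>p\<in>dominating U \<inter> {p. set p = U}. sort_weight t p)"
    using U by (intro sum.inter_restrict[symmetric]) (simp add: finite_dominating)
  also have "dominating U \<inter> {p. set p = U} = {p. p \<noteq> [] \<and> p \<in> permutations_of_set U}"
    by (auto simp: dominating_def permutations_of_set_def)
  finally show ?thesis by (simp add: perm_sum_def chain_gf_Suc chain_gf_0 extend_def)
qed

lemma sum_Pow_by_card:
  fixes f :: "nat \<Rightarrow> 'a::comm_semiring_1"
  assumes "finite V"
  shows "(\<Sum>S\<in>Pow V. f (card S)) = (\<Sum>k\<le>card V. of_nat (card V choose k) * f k)"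
proof -
  have "(\<Sum>S\<in>Pow V. f (card S)) = (\<Sum>k\<le>card V. \<Sum>S | S \<in> Pow V \<and> card S = k. f (card S))"
    using assms by (intro sum.group[symmetric]) (auto intro: card_mono)
  also have "\<dots> = (\<Sum>k\<le>card V. of_nat (card V choose k) * f k)"
    using assms by (intro sum.cong) (auto simp: n_subsets)
  finally show ?thesis .
qed

text \<open>Stated relative to the invariance hypothesis, because that invariance is itself proved by induction
  from this recurrence.\<close>

lemma chain_gf_insert_max:
  assumes V: "finite V" "\<forall>x\<in>V. x < m"
    and inv: "\<And>U j. finite U \<Longrightarrow> card U \<le> card V \<Longrightarrow> chain_gf t j U = chain_gf t j {1..card U}"
  shows "chain_gf t (Suc j) (insert m V) =
    (let n = card V; c = \<lambda>j n. chain_gf t j {1..n} in c j n + 2 * c (Suc j) n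
       + t * (\<Sum>k\<le>n. of_nat (n choose k) * (c (Suc j) (n - k) * c 1 k))
       + (1 - t) * c (Suc (Suc j)) n)"
proof -
  have "(\<Sum>S\<in>Pow V. chain_gf t (Suc j) (V - S) * perm_sum t S) =
    (\<Sum>S\<in>Pow V. chain_gf t (Suc j) {1..card V - card S} * chain_gf t 1 {1..card S})"
  proof (rule sum.cong[OF refl])
    fix S assume "S \<in> Pow V"
    then have S: "S \<subseteq> V" "finite S" using V finite_subset by auto
    then have "card (V - S) = card V - card S" by (simp add: card_Diff_subset)
    then show "chain_gf t (Suc j) (V - S) * perm_sum t S =
       chain_gf t (Suc j) {1..card V - card S} * chain_gf t 1 {1..card S}"
      using S V by (subst inv) (auto simp: perm_sum_eq_chain_gf inv[of S] card_mono)
  qed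
  also have "\<dots> = (\<Sum>k\<le>card V. of_nat (card V choose k) *
       (chain_gf t (Suc j) {1..card V - k} * chain_gf t 1 {1..k}))"
    using V(1) by (rule sum_Pow_by_card)
  finally show ?thesis
    using extend_insert_max[OF V, of t "chain_gf t j"] inv[OF V(1), of j] inv[OF V(1), of "Suc j"]
      inv[OF V(1), of "Suc (Suc j)"]
    by (simp add: chain_gf_Suc Let_def)
qed

text \<open>Only the relative order of the elements should matter.  No relabelling is needed to see this:
  the recurrence expresses the value on a set through values on smaller sets and their sizes.\<close>

lemma chain_gf_card: "finite U \<Longrightarrow> chain_gf t j U = chain_gf t j {1..card U}"
proof (induction "card U" arbitrary: U j rule: less_induct)
  case less
  show ?case
  proof (cases "U = {} \<or> j = 0")
    case True
    then show ?thesis using less.prems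
      by (cases "U = {}") (auto simp: chain_gf_0 at_empty_def card_gt_0_iff Suc_le_eq)
  next
    case False
    then obtain i where j: "j = Suc i" by (cases j) auto
    define n where "n = card U - 1"
    have cU: "card U = Suc n" using False less.prems by (auto simp: n_def card_gt_0_iff)
    have "Max U \<in> U" using False less.prems by simp
    then have U: "U = insert (Max U) (U - {Max U})" by auto
    have c: "card (U - {Max U}) = n" using \<open>Max U \<in> U\<close> less.prems cU by simp
    have less_Max: "\<forall>x\<in>U - {Max U}. x < Max U" using less.prems by (simp add: order.strict_iff_order)
    have inv: "chain_gf t i W = chain_gf t i {1..card W}" if "finite W" "card W \<le> n" for W i
      using less.hyps[of W i] that cU by simp
    note rec = chain_gf_insert_max[where t = t and j = i]
    have "chain_gf t (Suc i) (insert (Max U) (U - {Max U})) = chain_gf t (Suc i) (insert (Suc n) {1..n})"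
      by (rule trans[OF rec sym[OF trans[OF rec]]])
        (use less.prems less_Max in \<open>auto simp only: c card_atLeastAtMost diff_Suc_1
            atLeastAtMost_iff less_Suc_eq_le intro: inv\<close>)
    moreover have "insert (Suc n) {1..n} = {1..card U}" using cU by auto
    ultimately show ?thesis using U j by metis
  qed
qed

definition chain_seq :: "'a::comm_ring_1 \<Rightarrow> nat \<Rightarrow> nat \<Rightarrow> 'a" where
  "chain_seq t j n = chain_gf t j {1..n}"

lemma chain_seq_Suc_Suc:
  "chain_seq t (Suc j) (Suc n) = chain_seq t j n + 2 * chain_seq t (Suc j) n
       + t * (\<Sum>k\<le>n. of_nat (n choose k) * (chain_seq t (Suc j) (n - k) * chain_seq t 1 k))
       + (1 - t) * chain_seq t (Suc (Suc j)) n"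
proof -
  have "chain_gf t (Suc j) (insert (Suc n) {1..n}) = chain_gf t (Suc j) {1..Suc n}"
    by (rule arg_cong[where f = "chain_gf t (Suc j)"]) auto
  then show ?thesis
    using chain_gf_insert_max[of "{1..n}" "Suc n" t j, OF _ _ chain_gf_card]
    by (simp add: chain_seq_def Let_def)
qed

lemma chain_seq_Suc_0: "chain_seq t (Suc j) 0 = 0"
  by (simp add: chain_seq_def chain_gf_Suc_empty)

lemma chain_seq_1:
  assumes "n > 0"
  shows "chain_seq t 1 n = (\<Sum>p\<in>permutations_of_set {1..n}. t ^ des (stack_sort p))"
proof -
  have "{p. p \<noteq> [] \<and> p \<in> permutations_of_set {1..n}} = permutations_of_set {1..n}"
    using assms by (auto simp: permutations_of_set_def)
  then show ?thesis
    using perm_sum_eq_chain_gf[of "{1..n}" t]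
    by (simp only: chain_seq_def perm_sum_def sort_weight_def finite_atLeastAtMost)
qed

section \<open>Expansion of the generating functions around weight one\<close>

unbundle no vec_syntax
unbundle fps_syntax

text \<open>The weight is \<open>t = 1 + \<epsilon>\<close> with \<open>\<epsilon>\<close> the formal variable of the coefficient ring; the series
  collects the coefficients of \<open>\<epsilon> ^ i\<close>.\<close>

definition moment_egf :: "nat \<Rightarrow> nat \<Rightarrow> real fps" where
  "moment_egf j i = Abs_fps (\<lambda>n. (chain_seq (1 + fps_X :: real fps) j n $ i) / fact n)"

lemma moment_egf_nth_0: "moment_egf (Suc j) i $ 0 = 0"
  by (simp add: moment_egf_def chain_seq_Suc_0)

text \<open>Binomial convolution is the product of exponential generating functions, and extracting the
  coefficient of \<open>\<epsilon> ^ i\<close> adds a Cauchy product over the orders.\<close>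

lemma egf_product_coeff:
  fixes u v :: "nat \<Rightarrow> real fps"
  shows "Abs_fps (\<lambda>n. ((\<Sum>k\<le>n. of_nat (n choose k) * (u (n - k) * v k)) $ i) / fact n) =
    (\<Sum>q\<le>i. Abs_fps (\<lambda>n. u n $ (i - q) / fact n) * Abs_fps (\<lambda>n. v n $ q / fact n))"
proof (rule fps_ext)
  fix n
  have c: "real (n choose k) / fact n = 1 / (fact (n - k) * fact k)" if "k \<le> n" for k
    using binomial_fact[OF that, where 'a = real] by simp
  have nat: "(of_nat m * f) $ i = real m * f $ i" for m and f :: "real fps"
    by (metis fps_mult_left_const_nth fps_of_nat)
  have "((\<Sum>k\<le>n. of_nat (n choose k) * (u (n - k) * v k)) $ i) / fact n =
     (\<Sum>k\<le>n. real (n choose k) * (v k * u (n - k)) $ i / fact n)"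
    by (simp only: fps_sum_nth nat sum_divide_distrib mult.commute[of "u _"])
  also have "\<dots> = (\<Sum>k\<le>n. real (n choose k) / fact n * (\<Sum>q\<le>i. u (n - k) $ (i - q) * v k $ q))"
    by (simp add: fps_mult_nth atLeast0AtMost mult.commute[of "u _ $ _"])
  also have "\<dots> = (\<Sum>k\<le>n. \<Sum>q\<le>i. (u (n - k) $ (i - q) / fact (n - k)) * (v k $ q / fact k))"
    by (intro sum.cong refl) (simp add: c sum_distrib_left)
  also have "\<dots> = (\<Sum>q\<le>i. \<Sum>k\<le>n. (v k $ q / fact k) * (u (n - k) $ (i - q) / fact (n - k)))"
    by (subst sum.swap) (simp add: mult.commute)
  also have "\<dots> = (\<Sum>q\<le>i. Abs_fps (\<lambda>n. u n $ (i - q) / fact n) * Abs_fps (\<lambda>n. v n $ q / fact n)) $ n"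
    by (simp add: fps_sum_nth mult.commute[of "Abs_fps (\<lambda>n. u n $ _ / fact n)"] fps_mult_nth atLeast0AtMost)
  finally show "Abs_fps (\<lambda>n. ((\<Sum>k\<le>n. of_nat (n choose k) * (u (n - k) * v k)) $ i) / fact n) $ n =
      (\<Sum>q\<le>i. Abs_fps (\<lambda>n. u n $ (i - q) / fact n) * Abs_fps (\<lambda>n. v n $ q / fact n)) $ n"
    by simp
qed

text \<open>The factor \<open>t = 1 + \<epsilon>\<close> yields the convolution at orders \<open>i\<close> and \<open>i - 1\<close>, while
  \<open>1 - t = - \<epsilon>\<close> couples to chains with one list more only at order \<open>i - 1\<close>.  This is what makes the
  system triangular.\<close>

lemma moment_egf_deriv:
  "fps_deriv (moment_egf (Suc j) i) = moment_egf j i + 2 * moment_egf (Suc j) i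
     + (\<Sum>q\<le>i. moment_egf (Suc j) (i - q) * moment_egf 1 q)
     + (if i = 0 then 0
        else (\<Sum>q\<le>i - 1. moment_egf (Suc j) (i - 1 - q) * moment_egf 1 q) - moment_egf (Suc (Suc j)) (i - 1))"
proof -
  define t where "t = (1 + fps_X :: real fps)"
  define w where "w n = (\<Sum>k\<le>n. of_nat (n choose k) * (chain_seq t (Suc j) (n - k) * chain_seq t 1 k))" for n
  have w: "Abs_fps (\<lambda>n. w n $ i / fact n) = (\<Sum>q\<le>i. moment_egf (Suc j) (i - q) * moment_egf 1 q)" for i
    unfolding w_def moment_egf_def t_def by (rule egf_product_coeff)
  have "fps_deriv (moment_egf (Suc j) i) $ n =
    (moment_egf j i + 2 * moment_egf (Suc j) i + Abs_fps (\<lambda>n. w n $ i / fact n)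
     + (if i = 0 then 0 else Abs_fps (\<lambda>n. w n $ (i - 1) / fact n) - moment_egf (Suc (Suc j)) (i - 1))) $ n" for n
  proof -
    have "fps_deriv (moment_egf (Suc j) i) $ n = chain_seq t (Suc j) (Suc n) $ i / fact n"
      by (simp add: moment_egf_def t_def del: of_nat_Suc)
    also have "chain_seq t (Suc j) (Suc n) = chain_seq t j n + 2 * chain_seq t (Suc j) n
       + (w n + fps_X * w n) - fps_X * chain_seq t (Suc (Suc j)) n"
      unfolding chain_seq_Suc_Suc w_def by (simp add: t_def algebra_simps)
    finally show ?thesis
      by (cases i) (simp_all add: moment_egf_def t_def add_divide_distrib diff_divide_distrib)
  qed
  then show ?thesis unfolding w by (intro fps_ext) blast
qed

lemma moment_egf_1_nth:
  assumes "n > 0"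
  shows "moment_egf 1 i $ n = (\<Sum>p\<in>permutations_of_set {1..n}. real (des (stack_sort p) choose i)) / fact n"
proof -
  have "((1 + fps_X :: real fps) ^ d) $ i = real (d choose i)" for d
    by (simp add: fps_binomial_of_nat[symmetric] binomial_gbinomial)
  then show ?thesis using assms by (simp add: moment_egf_def chain_seq_1[simplified] fps_sum_nth)
qed

section \<open>Solving the triangular system\<close>

lemma fps_linear_ode_unique:
  fixes y z p g :: "real fps"
  assumes "fps_deriv y = p * y + g" "fps_deriv z = p * z + g" "y $ 0 = z $ 0"
  shows "y = z"
proof (rule fps_ext)
  fix n show "y $ n = z $ n"
  proof (induction n rule: less_induct)
    case (less n)
    show ?case
    proof (cases n)
      case 0 then show ?thesis using assms by simp
    next
      case (Suc m)
      have "real n * y $ n = fps_deriv y $ m" using Suc by simp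
      also have "\<dots> = fps_deriv z $ m"
        unfolding assms using less Suc by (simp add: fps_mult_nth)
      also have "\<dots> = real n * z $ n" using Suc by simp
      finally show ?thesis using Suc by simp
    qed
  qed
qed

abbreviation (input) geom :: "real fps" where "geom \<equiv> inverse (1 - fps_X)"
abbreviation (input) expo :: "real fps" where "expo \<equiv> fps_exp 1"

lemma geom_eq: "(1 - fps_X) * geom = 1"
  by (simp add: inverse_mult_eq_1')

lemma geom_nth: "geom $ n = 1"
  by (simp add: fps_inverse_one_minus_fps_X)

lemma deriv_geom: "fps_deriv geom = geom\<^sup>2"
  by (simp add: fps_inverse_deriv)

lemma moment_egf_1_0: "moment_egf 1 0 = fps_X * geom"
proof (rule fps_ext)
  fix n show "moment_egf 1 0 $ n = (fps_X * geom) $ n"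
  proof (cases "n = 0")
    case True then show ?thesis using moment_egf_nth_0[of 0 0] by simp
  next
    case False
    then have "moment_egf 1 0 $ n = 1"
      by (subst moment_egf_1_nth) simp_all
    then show ?thesis using False by (simp add: geom_nth del: One_nat_def)
  qed
qed

lemma fps_deriv_atoms:
  "fps_deriv (fps_X :: real fps) = 1" "fps_deriv (1 :: real fps) = 0" "fps_deriv (numeral k :: real fps) = 0"
  "fps_deriv (- numeral k :: real fps) = 0"
  "fps_deriv (fps_X ^ 2 :: real fps) = 2 * fps_X" "fps_deriv (fps_X ^ 3 :: real fps) = 3 * fps_X ^ 2"
  "fps_deriv (fps_X ^ 4 :: real fps) = 4 * fps_X ^ 3"
  "fps_deriv expo = expo" "fps_deriv (expo ^ 2) = 2 * expo ^ 2"
  "fps_deriv geom = geom ^ 2" "fps_deriv (geom ^ 2) = 2 * geom ^ 3" "fps_deriv (geom ^ 3) = 3 * geom ^ 4"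
  by (simp_all add: deriv_geom fps_deriv_power eval_nat_numeral algebra_simps)

lemmas fps_deriv_expand = fps_deriv_mult fps_deriv_add fps_deriv_sub fps_deriv_atoms

lemma moment_egf_0: "moment_egf 0 0 = 1" "moment_egf 0 (Suc i) = 0"
  by (auto simp: moment_egf_def chain_seq_def chain_gf_0 at_empty_def fps_eq_iff)

text \<open>The equations at the orders that enter the second moment.  The factor \<open>2 + Y\<^sub>1\<close> at order zero
  equals \<open>1 + 1 / (1 - z)\<close>.\<close>

lemma moment_egf_deriv_order:
  "fps_deriv (moment_egf (Suc j) 0) = moment_egf j 0 + (1 + geom) * moment_egf (Suc j) 0" (is ?A)
  "fps_deriv (moment_egf (Suc j) 1) = moment_egf j 1 + (1 + geom) * moment_egf (Suc j) 1
     + moment_egf (Suc j) 0 * (moment_egf 1 1 + fps_X * geom) - moment_egf (Suc (Suc j)) 0" (is ?B)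
  "fps_deriv (moment_egf (Suc j) 2) = moment_egf j 2 + (1 + geom) * moment_egf (Suc j) 2
     + moment_egf (Suc j) 1 * (moment_egf 1 1 + fps_X * geom)
     + moment_egf (Suc j) 0 * (moment_egf 1 2 + moment_egf 1 1) - moment_egf (Suc (Suc j)) 1" (is ?C)
proof -
  have *: "fps_X * geom = geom - 1" using geom_eq by (simp add: algebra_simps)
  have sum1: "(\<Sum>q\<le>1. f q) = f 0 + f 1" and sum2: "(\<Sum>q\<le>2. f q) = f 0 + f 1 + f 2"
    for f :: "nat \<Rightarrow> real fps" by (simp_all add: eval_nat_numeral)
  show ?A using moment_egf_deriv[of j 0] by (simp add: moment_egf_1_0[simplified] * algebra_simps)
  show ?B using moment_egf_deriv[of j 1] unfolding sum1 by (simp add: moment_egf_1_0[simplified] * algebra_simps)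
  show ?C using moment_egf_deriv[of j 2] unfolding sum2
    by (simp add: sum1[simplified] moment_egf_1_0[simplified] * algebra_simps)
qed

text \<open>The closed form comes from variation of constants.  By uniqueness it suffices that it satisfies
  the same linear equation and vanishes at \<open>0\<close>; the same holds for the other components.\<close>

lemma moment_egf_2_0: "moment_egf 2 0 = (expo - 1 - fps_X) * geom"
proof (rule fps_linear_ode_unique[where p = "1 + geom" and g = "fps_X * geom"])
  show "fps_deriv (moment_egf 2 0) = (1 + geom) * moment_egf 2 0 + fps_X * geom"
    using moment_egf_deriv_order(1)[of 1] by (simp add: numeral_2_eq_2 moment_egf_1_0[simplified])
  show "fps_deriv ((expo - 1 - fps_X) * geom) = (1 + geom) * ((expo - 1 - fps_X) * geom) + fps_X * geom"
    unfolding fps_deriv_expand by algebra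
qed (use moment_egf_nth_0[of 1 0] in \<open>simp add: numeral_2_eq_2\<close>)

lemma moment_egf_3_0: "moment_egf 3 0 = ((fps_X - 2) * expo + 2 + fps_X) * geom"
proof (rule fps_linear_ode_unique[where p = "1 + geom" and g = "moment_egf 2 0"])
  show "fps_deriv (moment_egf 3 0) = (1 + geom) * moment_egf 3 0 + moment_egf 2 0"
    using moment_egf_deriv_order(1)[of 2] by (simp add: eval_nat_numeral)
  show "fps_deriv (((fps_X - 2) * expo + 2 + fps_X) * geom) =
    (1 + geom) * (((fps_X - 2) * expo + 2 + fps_X) * geom) + moment_egf 2 0"
    unfolding moment_egf_2_0 fps_deriv_expand by algebra
qed (use moment_egf_nth_0[of 2 0] in \<open>simp add: eval_nat_numeral\<close>)

text \<open>For chains of length one the unknown also occurs in the factor \<open>t Y\<^sub>1\<close>, so the homogeneous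
  coefficient is \<open>2 / (1 - z)\<close> at every positive order.\<close>

lemma moment_egf_1_1: "moment_egf 1 1 = (2 + fps_X - (2 - fps_X) * expo) * geom^2"
proof (rule fps_linear_ode_unique[where p = "2 * geom" and g = "(fps_X * geom)^2 - moment_egf 2 0"])
  show "fps_deriv (moment_egf 1 1) = 2 * geom * moment_egf 1 1 + ((fps_X * geom)\<^sup>2 - moment_egf 2 0)"
    using moment_egf_deriv_order(2)[of 0] geom_eq
    by (simp add: moment_egf_1_0[simplified] moment_egf_0 eval_nat_numeral, algebra)
  show "fps_deriv ((2 + fps_X - (2 - fps_X) * expo) * geom\<^sup>2) =
    2 * geom * ((2 + fps_X - (2 - fps_X) * expo) * geom\<^sup>2) + ((fps_X * geom)\<^sup>2 - moment_egf 2 0)"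
    unfolding moment_egf_2_0 fps_deriv_expand using geom_eq by algebra
qed (use moment_egf_nth_0[of 0 1] in \<open>simp\<close>)

lemma moment_egf_2_1:
  "2 * moment_egf 2 1 = (- 4 * (fps_X + 2) + (10 - 2 * fps_X + fps_X^2 + fps_X^3) * expo
     - 2 * expo^2) * geom^2" (is "_ = ?y")
proof -
  let ?g = "2 * (moment_egf 1 1 + moment_egf 1 1 * moment_egf 2 0
              + fps_X * geom * moment_egf 2 0 - moment_egf 3 0)"
  show ?thesis
  proof (rule fps_linear_ode_unique[where p = "1 + geom" and g = ?g])
    show "fps_deriv (2 * moment_egf 2 1) = (1 + geom) * (2 * moment_egf 2 1) + ?g"
      using arg_cong[where f = "\<lambda>x. 2 * x", OF moment_egf_deriv_order(2)[of 1]]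
      by (simp add: eval_nat_numeral algebra_simps)
    show "fps_deriv ?y = (1 + geom) * ?y + ?g"
      unfolding moment_egf_2_0 moment_egf_1_1 moment_egf_3_0 fps_deriv_expand using geom_eq by algebra
  qed (use moment_egf_nth_0[of 1 1] in \<open>simp add: eval_nat_numeral\<close>)
qed

lemma moment_egf_1_2:
  "2 * moment_egf 1 2 = (4 + 12 * fps_X + 2 * fps_X^2
     + (- 8 - 10 * fps_X + 8 * fps_X^2 - 3 * fps_X^3 + fps_X^4) * expo
     + (4 - 2 * fps_X) * expo^2) * geom^3" (is "_ = ?y")
proof -
  let ?g = "2 * (moment_egf 1 1)^2 + 4 * fps_X * geom * moment_egf 1 1 - 2 * moment_egf 2 1"
  show ?thesis
  proof (rule fps_linear_ode_unique[where p = "2 * geom" and g = ?g])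
    show "fps_deriv (2 * moment_egf 1 2) = 2 * geom * (2 * moment_egf 1 2) + ?g"
      using moment_egf_deriv_order(3)[of 0] geom_eq
      by (simp add: moment_egf_1_0[simplified] moment_egf_0 eval_nat_numeral, algebra)
    show "fps_deriv ?y = 2 * geom * ?y + ?g"
      unfolding moment_egf_2_1 moment_egf_1_1 fps_deriv_expand using geom_eq by algebra
  qed (use moment_egf_nth_0[of 0 2] in \<open>simp add: eval_nat_numeral\<close>)
qed

section \<open>The first two moments\<close>

text \<open>The numerators over \<open>1 - z\<close> and \<open>(1 - z)\<^sup>2\<close> of the series with coefficients
  \<open>E(D\<^sub>n) / n\<close> and \<open>E(D\<^sub>n\<^sup>2) / n\<close>.\<close>

definition mean_num :: "real fps" where "mean_num = 1 + 2 * fps_X - expo"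
definition square_num :: "real fps" where
  "square_num = 2 + 7 * fps_X - (3 + 5 * fps_X - 3 * fps_X ^ 2 + fps_X ^ 3) * expo + expo ^ 2"

lemma deriv_mean_num: "fps_deriv (mean_num * geom) = geom + moment_egf 1 1"
  unfolding mean_num_def moment_egf_1_1 fps_deriv_expand using geom_eq by algebra

lemma deriv_square_num: "fps_deriv (square_num * geom ^ 2) = geom + 3 * moment_egf 1 1 + 2 * moment_egf 1 2"
  unfolding square_num_def moment_egf_1_1 moment_egf_1_2 fps_deriv_expand using geom_eq by algebra

lemma expectation_unif_perm:
  fixes f :: "nat list \<Rightarrow> real"
  shows "measure_pmf.expectation (unif_perm m) f = (\<Sum>p\<in>permutations_of_set {1..m}. f p) / fact m"
  unfolding unif_perm_def by (subst integral_pmf_of_set) auto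

text \<open>Here \<open>D\<close> lives on \<open>S\<^sub>m\<close> with \<open>m = 0\<close> included, where the empty permutation has \<open>D = 1\<close>: chains
  of length one omit it, but the summand \<open>1 / (1 - z)\<close> supplies it.\<close>

lemma expectation_D_egf: "(geom + moment_egf 1 1) $ m = measure_pmf.expectation (unif_perm m) D"
  "(geom + 3 * moment_egf 1 1 + 2 * moment_egf 1 2) $ m = measure_pmf.expectation (unif_perm m) (\<lambda>p. (D p)\<^sup>2)"
proof -
  have D1: "D p = 1 + real (des (stack_sort p) choose 1)" for p by (simp add: D_def)
  have D2: "(D p)\<^sup>2 = 1 + 3 * real (des (stack_sort p) choose 1) + 2 * real (des (stack_sort p) choose 2)" for p
  proof -
    have "2 * real (d choose 2) = real d * (real d - 1)" for d
      by (induction d) (simp_all add: numeral_2_eq_2 algebra_simps)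
    then show ?thesis by (simp add: D_def power2_eq_square algebra_simps)
  qed
  have nth1: "moment_egf 1 i $ m = (\<Sum>p\<in>permutations_of_set {1..m}. real (des (stack_sort p) choose i)) / fact m"
    if "i > 0" for i
    using that moment_egf_1_nth[of m i] moment_egf_nth_0[of 0 i]
    by (cases "m = 0") (simp_all add: stack_sort_Nil des_Nil)
  have card: "geom $ m = (\<Sum>p\<in>permutations_of_set {1..m}. 1) / fact m"
    by (simp add: geom_nth)
  have num: "(numeral k * f) $ m = numeral k * f $ m" for k and f :: "real fps"
    by (simp add: numeral_fps_const)
  show "(geom + moment_egf 1 1) $ m = measure_pmf.expectation (unif_perm m) D"
    "(geom + 3 * moment_egf 1 1 + 2 * moment_egf 1 2) $ m = measure_pmf.expectation (unif_perm m) (\<lambda>p. (D p)\<^sup>2)"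
    unfolding expectation_unif_perm
    unfolding sum.cong[OF refl D1, where A = "permutations_of_set {1..m}"]
      sum.cong[OF refl D2, where A = "permutations_of_set {1..m}"]
    by (simp_all only: fps_add_nth num nth1 card sum.distrib sum_distrib_left[symmetric]
        add_divide_distrib times_divide_eq_right zero_less_numeral zero_less_one)
qed

text \<open>Differentiation cancels the denominator \<open>n\<close> and shifts the index, which matches the
  permutations of \<open>n - 1\<close> elements.\<close>

lemma expectation_D:
  assumes "n \<ge> 1"
  shows "measure_pmf.expectation (unif_perm (n - 1)) D = real n * (mean_num * geom) $ n"
    "measure_pmf.expectation (unif_perm (n - 1)) (\<lambda>p. (D p)\<^sup>2) = real n * (square_num * geom ^ 2) $ n"
proof -
  have *: "fps_deriv f $ (n - 1) = real n * f $ n" for f :: "real fps"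
    using assms by (simp add: fps_deriv_nth)
  show "measure_pmf.expectation (unif_perm (n - 1)) D = real n * (mean_num * geom) $ n"
    unfolding expectation_D_egf[symmetric] deriv_mean_num[symmetric] by (rule *)
  show "measure_pmf.expectation (unif_perm (n - 1)) (\<lambda>p. (D p)\<^sup>2) = real n * (square_num * geom ^ 2) $ n"
    unfolding expectation_D_egf[symmetric] deriv_square_num[symmetric] by (rule *)
qed

section \<open>Coefficients of entire series over powers of 1 - z\<close>

definition entire :: "real fps \<Rightarrow> bool" where "entire f \<longleftrightarrow> fps_conv_radius f = \<infinity>"

lemma entire_basic: "entire 1" "entire (numeral k)" "entire fps_X" "entire (fps_exp c)"
  by (auto simp: entire_def)

lemma entire_arith:
  assumes "entire f" "entire g"
  shows "entire (f + g)" "entire (f - g)" "entire (f * g)"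
  using fps_conv_radius_add[of f g] fps_conv_radius_diff[of f g] fps_conv_radius_mult[of f g] assms
  by (auto simp: entire_def)

lemma entire_power: "entire f \<Longrightarrow> entire (f ^ n)"
  using fps_conv_radius_power[of f n] by (auto simp: entire_def)

lemma eval_entire:
  assumes "entire f" "entire g"
  shows "eval_fps (f + g) x = eval_fps f x + eval_fps g x"
    "eval_fps (f - g) x = eval_fps f x - eval_fps g x"
    "eval_fps (f * g) x = eval_fps f x * eval_fps g x"
  using assms by (auto simp: entire_def eval_fps_add eval_fps_diff eval_fps_mult)

lemma eval_entire_power: "entire f \<Longrightarrow> eval_fps (f ^ n) x = eval_fps f x ^ n"
  by (simp add: entire_def eval_fps_power)

lemma entire_deriv: "entire f \<Longrightarrow> entire (fps_deriv f)"
  using fps_conv_radius_deriv[of f] by (auto simp: entire_def)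

lemma entire_sums: "entire f \<Longrightarrow> (\<lambda>n. f $ n) sums eval_fps f 1"
  using sums_eval_fps[of 1 f] by (simp add: entire_def)

lemma entire_partial_sums: "entire f \<Longrightarrow> (\<lambda>n. \<Sum>k\<le>n. f $ k) \<longlonglongrightarrow> eval_fps f 1"
  using entire_sums[of f] by (simp add: sums_def_le)

lemma entire_weighted_sums:
  assumes "entire f"
  shows "(\<lambda>n. \<Sum>k\<le>n. real k * f $ k) \<longlonglongrightarrow> eval_fps (fps_deriv f) 1"
    "summable (\<lambda>k. \<bar>real k * f $ k\<bar>)"
proof -
  have nth: "(fps_X * fps_deriv f) $ k = real k * f $ k" for k by (cases k) simp_all
  have ent: "entire (fps_X * fps_deriv f)" using assms by (intro entire_arith entire_deriv entire_basic)
  show "(\<lambda>n. \<Sum>k\<le>n. real k * f $ k) \<longlonglongrightarrow> eval_fps (fps_deriv f) 1"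
    using entire_partial_sums[OF ent] assms
    by (simp only: nth eval_entire entire_deriv entire_basic eval_fps_X mult_1)
  show "summable (\<lambda>k. \<bar>real k * f $ k\<bar>)"
    using norm_summable_fps[of 1 "fps_X * fps_deriv f"] ent unfolding nth entire_def by simp
qed

text \<open>The remainder beyond index \<open>n\<close>, multiplied by \<open>n\<close>, is dominated by the tail of the convergent
  series with terms \<open>k * \<bar>f\<^sub>k\<bar>\<close>.\<close>

lemma entire_tail:
  assumes "entire f"
  shows "(\<lambda>n. real n * ((\<Sum>k\<le>n. f $ k) - eval_fps f 1)) \<longlonglongrightarrow> 0"
proof (rule Lim_null_comparison)
  let ?a = "\<lambda>k. \<bar>real k * f $ k\<bar>"
  note a = entire_weighted_sums(2)[OF assms]
  show "(\<lambda>n. \<Sum>k. ?a (k + Suc n)) \<longlonglongrightarrow> 0"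
    using LIMSEQ_Suc[OF suminf_exist_split2[OF a]] .
  show "\<forall>\<^sub>F n in sequentially. norm (real n * ((\<Sum>k\<le>n. f $ k) - eval_fps f 1)) \<le> (\<Sum>k. ?a (k + Suc n))"
  proof (intro always_eventually allI)
    fix n
    note s = entire_sums[OF assms]
    have sum_f: "summable (\<lambda>k. f $ (k + Suc n))"
      using s by (subst summable_iff_shift) (rule sums_summable)
    have "eval_fps f 1 = (\<Sum>k. f $ (k + Suc n)) + (\<Sum>k\<le>n. f $ k)"
      using suminf_split_initial_segment[OF sums_summable[OF s], of "Suc n"] sums_unique[OF s]
      by (simp add: lessThan_Suc_atMost)
    then have "norm (real n * ((\<Sum>k\<le>n. f $ k) - eval_fps f 1)) = norm (\<Sum>k. real n * f $ (k + Suc n))"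
      using sum_f by (simp add: suminf_mult abs_mult)
    also have "\<dots> \<le> (\<Sum>k. ?a (k + Suc n))"
    proof (rule norm_suminf_le)
      show "norm (real n * f $ (k + Suc n)) \<le> ?a (k + Suc n)" for k
        by (simp add: abs_mult mult_right_mono)
      show "summable (\<lambda>k. ?a (k + Suc n))" using a by (subst summable_iff_shift)
    qed
    finally show "norm (real n * ((\<Sum>k\<le>n. f $ k) - eval_fps f 1)) \<le> (\<Sum>k. ?a (k + Suc n))" .
  qed
qed

lemma nth_simple_pole: "(f * geom) $ n = (\<Sum>k\<le>n. f $ k)"
  by (simp add: fps_mult_nth geom_nth atLeast0AtMost)

lemma nth_double_pole: "(f * geom ^ 2) $ n = (real n + 1) * (\<Sum>k\<le>n. f $ k) - (\<Sum>k\<le>n. real k * f $ k)"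
proof -
  have "(f * geom ^ 2) $ n = (\<Sum>k\<le>n. f $ k * real (n - k + 1))"
    using fps_one_over_one_minus_fps_X_squared[where 'a = real]
    by (simp add: fps_mult_nth atLeast0AtMost fps_inverse_power)
  also have "\<dots> = (\<Sum>k\<le>n. (real n + 1) * f $ k - real k * f $ k)"
    by (intro sum.cong) (auto simp: of_nat_diff algebra_simps)
  finally show ?thesis by (simp add: sum_subtractf sum_distrib_left)
qed

text \<open>The two partial sums are \<open>c + \<sigma>\<close> and \<open>c\<^sup>2 + \<tau>\<close>, where \<open>\<sigma>\<close> and \<open>\<tau>\<close> vanish faster than
  \<open>1 / n\<close>.  The hypothesis on the values at \<open>1\<close> makes the terms of order \<open>n\<close> cancel, so that the
  limit comes from the next term of the double pole.\<close>

lemma pole_difference_limit: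
  assumes "entire f" "entire g" and C: "eval_fps g 1 = (eval_fps f 1)\<^sup>2"
  shows "(\<lambda>n. (g * geom ^ 2) $ n - real n * ((f * geom) $ n)\<^sup>2) \<longlonglongrightarrow> eval_fps g 1 - eval_fps (fps_deriv g) 1"
proof -
  define c where "c = eval_fps f 1"
  define \<sigma> where "\<sigma> n = (\<Sum>k\<le>n. f $ k) - c" for n
  define \<tau> where "\<tau> n = (\<Sum>k\<le>n. g $ k) - c\<^sup>2" for n
  define q where "q n = (\<Sum>k\<le>n. real k * g $ k)" for n
  have \<sigma>: "\<sigma> \<longlonglongrightarrow> 0" "(\<lambda>n. real n * \<sigma> n) \<longlonglongrightarrow> 0"
    using LIM_zero[OF entire_partial_sums[OF assms(1)]] entire_tail[OF assms(1)]
    unfolding \<sigma>_def c_def by simp_all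
  have \<tau>: "\<tau> \<longlonglongrightarrow> 0" "(\<lambda>n. real n * \<tau> n) \<longlonglongrightarrow> 0"
    using LIM_zero[OF entire_partial_sums[OF assms(2)]] entire_tail[OF assms(2)]
    unfolding \<tau>_def c_def C by simp_all
  have q: "q \<longlonglongrightarrow> eval_fps (fps_deriv g) 1"
    unfolding q_def by (rule entire_weighted_sums(1)[OF assms(2)])
  have eq: "(g * geom ^ 2) $ n - real n * ((f * geom) $ n)\<^sup>2 =
      c\<^sup>2 + real n * \<tau> n + \<tau> n - q n - 2 * c * (real n * \<sigma> n) - real n * \<sigma> n * \<sigma> n" for n
  proof -
    have "(\<Sum>k\<le>n. f $ k) = c + \<sigma> n" "(\<Sum>k\<le>n. g $ k) = c\<^sup>2 + \<tau> n" by (simp_all add: \<sigma>_def \<tau>_def)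
    then show ?thesis
      unfolding nth_double_pole nth_simple_pole q_def[symmetric]
      by (simp add: power2_eq_square algebra_simps)
  qed
  have "(\<lambda>n. c\<^sup>2 + real n * \<tau> n + \<tau> n - q n - 2 * c * (real n * \<sigma> n) - real n * \<sigma> n * \<sigma> n)
     \<longlonglongrightarrow> c\<^sup>2 + 0 + 0 - eval_fps (fps_deriv g) 1 - 2 * c * 0 - 0 * 0"
    by (intro tendsto_intros \<sigma> \<tau> q)
  then show ?thesis unfolding eq C c_def[symmetric] by simp
qed

section \<open>Mean square and variance\<close>

lemma entire_nums: "entire mean_num" "entire square_num"
  unfolding mean_num_def square_num_def by (intro entire_arith entire_power entire_basic)+

lemma eval_mean_num: "eval_fps mean_num 1 = 3 - exp 1"
  unfolding mean_num_def by (simp add: eval_entire eval_entire_power entire_arith entire_power entire_basic)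

lemma eval_square_num: "eval_fps square_num 1 = (3 - exp 1)\<^sup>2"
  unfolding square_num_def
  by (simp add: eval_entire eval_entire_power entire_arith entire_power entire_basic)
    (simp add: power2_eq_square algebra_simps)

lemma eval_deriv_square_num: "eval_fps (fps_deriv square_num) 1 = 7 - 8 * exp 1 + 2 * (exp 1)\<^sup>2"
  unfolding square_num_def fps_deriv_expand
  by (simp add: eval_entire eval_entire_power entire_arith entire_power entire_basic)

lemma variance_D:
  assumes "n \<ge> 1"
  shows "measure_pmf.variance (unif_perm (n - 1)) D / real n =
     (square_num * geom ^ 2) $ n - real n * ((mean_num * geom) $ n)\<^sup>2"
proof -
  have int: "integrable (measure_pmf (unif_perm (n - 1))) f" for f :: "nat list \<Rightarrow> real"
    unfolding unif_perm_def by (intro integrable_measure_pmf_finite) simp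
  have "measure_pmf.variance (unif_perm (n - 1)) D =
     measure_pmf.expectation (unif_perm (n - 1)) (\<lambda>p. (D p)\<^sup>2)
     - (measure_pmf.expectation (unif_perm (n - 1)) D)\<^sup>2"
    by (rule measure_pmf.variance_eq[OF int int])
  also have "\<dots> = real n * (square_num * geom ^ 2) $ n - (real n * (mean_num * geom) $ n)\<^sup>2"
    unfolding expectation_D[OF assms] ..
  finally show ?thesis using assms by (simp add: diff_divide_distrib power_mult_distrib power2_eq_square)
qed

theorem theorem7p10:
  shows "(Abs_fps (\<lambda>n. if n \<ge> 1
           then measure_pmf.expectation (unif_perm (n - 1)) (\<lambda>\<sigma>. (D \<sigma>)\<^sup>2) / real n else 0) =
         (2 + 7 * fps_X - (3 + 5 * fps_X - 3 * fps_X ^ 2 + fps_X ^ 3) * fps_exp (1::real)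
           + fps_exp (2::real)) / (1 - fps_X) ^ 2) \<and>
         ((\<lambda>n. measure_pmf.variance (unif_perm (n - 1)) D)
           \<sim>[at_top] (\<lambda>n. (2 + 2 * exp 1 - (exp 1)\<^sup>2) * real n))"
proof
  have "fps_exp (2::real) = expo ^ 2" by (simp add: fps_exp_power_mult)
  then have "(2 + 7 * fps_X - (3 + 5 * fps_X - 3 * fps_X ^ 2 + fps_X ^ 3) * fps_exp (1::real)
           + fps_exp (2::real)) / (1 - fps_X) ^ 2 = square_num * geom ^ 2"
    by (simp add: square_num_def fps_divide_unit fps_inverse_power)
  moreover have "(square_num * geom ^ 2) $ 0 = 0"
    by (simp add: square_num_def power2_eq_square)
  ultimately show "Abs_fps (\<lambda>n. if n \<ge> 1
           then measure_pmf.expectation (unif_perm (n - 1)) (\<lambda>\<sigma>. (D \<sigma>)\<^sup>2) / real n else 0) =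
         (2 + 7 * fps_X - (3 + 5 * fps_X - 3 * fps_X ^ 2 + fps_X ^ 3) * fps_exp (1::real)
           + fps_exp (2::real)) / (1 - fps_X) ^ 2"
    by (auto intro!: fps_ext simp: expectation_D(2) not_le simp del: One_nat_def)
next
  \<comment> \<open>The constant equals \<open>3 - (e - 1)\<^sup>2\<close>, and \<open>1.72\<^sup>2 < 3\<close>.  It must not vanish for the asymptotic
    equivalence to follow from the limit of the quotient.\<close>
  have "exp 1 - 1 < (172/100::real)" using e_less_272 by simp
  moreover have "exp 1 - 1 > (0::real)" by simp
  ultimately have "(exp 1 - 1)\<^sup>2 < (172/100::real)\<^sup>2" by (intro power_strict_mono) auto
  then have c: "2 + 2 * exp 1 - (exp 1)\<^sup>2 \<noteq> (0::real)"
    by (simp add: power2_eq_square algebra_simps)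
  have "eval_fps square_num 1 - eval_fps (fps_deriv square_num) 1 = 2 + 2 * exp 1 - (exp 1)\<^sup>2"
    unfolding eval_square_num eval_deriv_square_num by (simp add: power2_eq_square algebra_simps)
  then have "(\<lambda>n. (square_num * geom ^ 2) $ n - real n * ((mean_num * geom) $ n)\<^sup>2) \<longlonglongrightarrow> 2 + 2 * exp 1 - (exp 1)\<^sup>2"
    using pole_difference_limit[OF entire_nums] by (simp add: eval_square_num eval_mean_num)
  moreover have "\<forall>\<^sub>F n in sequentially. (square_num * geom ^ 2) $ n - real n * ((mean_num * geom) $ n)\<^sup>2 =
      measure_pmf.variance (unif_perm (n - 1)) D / real n"
    using eventually_ge_at_top[of 1] by eventually_elim (rule variance_D[symmetric])
  ultimately have "(\<lambda>n. measure_pmf.variance (unif_perm (n - 1)) D / real n) \<longlonglongrightarrow> 2 + 2 * exp 1 - (exp 1)\<^sup>2"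
    by (rule Lim_transform_eventually)
  then show "(\<lambda>n. measure_pmf.variance (unif_perm (n - 1)) D)
           \<sim>[at_top] (\<lambda>n. (2 + 2 * exp 1 - (exp 1)\<^sup>2) * real n)"
    using c by (rule asymp_equivI'_const)
qed

end
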